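(* Let $G$ be a group, let $\mathcal{H}$ be a complex Hilbert space, let $U:G\to\mathcal{B}(\mathcal{H})$ be a unitary representation and let $n\in\mathbb{N}$. Then the map $U_n:G\to\mathcal{B}(\mathcal{H})$, $U_n(s)=U(s)^n$, is a unitary representation if and only if $U(g)=I_{\mathcal{H}}$ for every $g\in G_n$, where $G_n=\langle s^{-n+1}(ts)^{n-1}t^{-n+1}\mid s,t\in G\rangle$.
   Context: $\mathcal{B}(\mathcal{H})$ is the algebra of bounded linear operators on $\mathcal{H}$. A unitary representation of a group $G$ with identity $e$ is a map $U:G\to\mathcal{B}(\mathcal{H})$ such that each $U(s)$ is unitary, $U(e)=I_{\mathcal{H}}$ and $U(s)U(t)=U(st)$ for all $s,t\in G$. $\langle\,\cdot\,\rangle$ denotes the subgroup generated by the given elements; $\mathbb{N}=\{1,2,\dots\}$. *)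

theory Defs
  imports "HOL-Analysis.Inner_Product" "HOL-Algebra.Generated_Groups"
begin

text \<open>
  A complex Hilbert space: a complete real inner product space carrying a multiplication by complex
  scalars and a complex inner product, linear in the first argument, that extend the real ones.
  The real inner product of the underlying space is the real part of the complex one, so
  norm, topology and positive definiteness are those of \<open>cinner\<close>: by \<open>cinner_commute\<close> the number
  \<open>cinner x x\<close> is real, and hence equal to \<open>inner x x\<close>.
\<close>

class complex_hilbert_space = real_inner + complete_space +
  fixes scaleC :: "complex \<Rightarrow> 'a \<Rightarrow> 'a"
    and cinner :: "'a \<Rightarrow> 'a \<Rightarrow> complex"
  assumes scaleC_add_right: "scaleC a (x + y) = scaleC a x + scaleC a y"
    and scaleC_add_left: "scaleC (a + b) x = scaleC a x + scaleC b x"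
    and scaleC_scaleC: "scaleC a (scaleC b x) = scaleC (a * b) x"
    and scaleC_one: "scaleC 1 x = x"
    and scaleR_eq_scaleC: "scaleR r x = scaleC (complex_of_real r) x"
    and cinner_commute: "cinner x y = cnj (cinner y x)"
    and cinner_add_left: "cinner (x + y) z = cinner x z + cinner y z"
    and cinner_scaleC_left: "cinner (scaleC a x) y = a * cinner x y"
    and inner_eq_Re_cinner: "inner x y = Re (cinner x y)"

instantiation complex :: complex_hilbert_space
begin

definition scaleC_complex :: "complex \<Rightarrow> complex \<Rightarrow> complex"
  where "scaleC_complex a x = a * x"

definition cinner_complex :: "complex \<Rightarrow> complex \<Rightarrow> complex"
  where "cinner_complex x y = x * cnj y"

instance
  by standard
    (simp_all add: scaleC_complex_def cinner_complex_def inner_complex_def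
      scaleR_conv_of_real algebra_simps)

end

text \<open>The elements of \<open>\<B>(\<H>)\<close> are the functions satisfying the following predicate; their product is
  composition, and the identity operator is \<^const>\<open>id\<close>.\<close>

definition bounded_clinear ::
    "('h::complex_hilbert_space \<Rightarrow> 'h) \<Rightarrow> bool"
  where "bounded_clinear T \<longleftrightarrow>
    bounded_linear T \<and> (\<forall>a x. T (scaleC a x) = scaleC a (T x))"

definition is_cadjoint ::
    "('h::complex_hilbert_space \<Rightarrow> 'h) \<Rightarrow> ('h \<Rightarrow> 'h) \<Rightarrow> bool"
  where "is_cadjoint S T \<longleftrightarrow> (\<forall>x y. cinner (T x) y = cinner x (S y))"

text \<open>The adjoint of an operator is unique, so \<open>S\<close> below is the adjoint \<open>T\<^sup>*\<close>, and the condition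
  reads \<open>T\<^sup>* T = I = T T\<^sup>*\<close>.\<close>

definition unitary_op :: "('h::complex_hilbert_space \<Rightarrow> 'h) \<Rightarrow> bool"
  where "unitary_op T \<longleftrightarrow> bounded_clinear T \<and>
    (\<exists>S. bounded_clinear S \<and> is_cadjoint S T \<and> S \<circ> T = id \<and> T \<circ> S = id)"

definition unitary_representation ::
    "('g, 'm) monoid_scheme \<Rightarrow> ('g \<Rightarrow> 'h::complex_hilbert_space \<Rightarrow> 'h) \<Rightarrow> bool"
  where "unitary_representation G U \<longleftrightarrow>
    (\<forall>s\<in>carrier G. unitary_op (U s)) \<and>
    U \<one>\<^bsub>G\<^esub> = id \<and>
    (\<forall>s\<in>carrier G. \<forall>t\<in>carrier G. U s \<circ> U t = U (s \<otimes>\<^bsub>G\<^esub> t))"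

text \<open>The exponents are integers.\<close>

definition power_subgroup :: "('g, 'm) monoid_scheme \<Rightarrow> nat \<Rightarrow> 'g set"
  where "power_subgroup G n = generate G
    {s [^]\<^bsub>G\<^esub> (- int n + 1) \<otimes>\<^bsub>G\<^esub> (t \<otimes>\<^bsub>G\<^esub> s) [^]\<^bsub>G\<^esub> (int n - 1) \<otimes>\<^bsub>G\<^esub> t [^]\<^bsub>G\<^esub> (- int n + 1)
      | s t. s \<in> carrier G \<and> t \<in> carrier G}"

end

theory Submission imports Defs
begin

text \<open>
  Since \<open>(st)\<^sup>n = s (ts)\<^sup>n\<^sup>-\<^sup>1 t\<close>, the generator \<open>x = s\<^sup>-\<^sup>n\<^sup>+\<^sup>1 (ts)\<^sup>n\<^sup>-\<^sup>1 t\<^sup>-\<^sup>n\<^sup>+\<^sup>1\<close> of \<open>G\<^sub>n\<close> satisfies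
  \<open>(st)\<^sup>n = s\<^sup>n x t\<^sup>n\<close>. Applying \<open>U\<close> and cancelling, \<open>U(s)\<^sup>n U(t)\<^sup>n = U(st)\<^sup>n\<close> holds exactly when \<open>x\<close>
  lies in the kernel of \<open>U\<close>, which is a subgroup. Unitarity of \<open>U(s)\<^sup>n = U(s\<^sup>n)\<close> is automatic.
\<close>

text \<open>Regrouping of the alternating word \<open>s t s t ... s t\<close>: once its first
  \<open>s\<close> and last \<open>t\<close> are split off, \<open>m\<close> copies of
  \<open>t s\<close> remain.\<close>

lemma (in group) nat_pow_Suc_mult_swap:
  assumes "s \<in> carrier G" "t \<in> carrier G"
  shows "(s \<otimes> t) [^] Suc m = s \<otimes> (t \<otimes> s) [^] m \<otimes> t"
proof (induction m)
  case 0
  then show ?case using assms by simp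
next
  case (Suc m)
  have "(s \<otimes> t) [^] Suc (Suc m) = s \<otimes> (t \<otimes> s) [^] m \<otimes> t \<otimes> (s \<otimes> t)"
    using Suc by simp
  also have "\<dots> = s \<otimes> (t \<otimes> s) [^] Suc m \<otimes> t"
    using assms by (simp add: m_assoc)
  finally show ?case .
qed

text \<open>The outer powers absorb the negative ones, leaving a single \<open>s\<close> on the left
  and a single \<open>t\<close> on the right. Writing \<open>n = Suc m\<close> turns the middle
  integer power into a natural one, so that the regrouping above applies.\<close>

lemma (in group) nat_pow_mult_eq_generator:
  assumes "s \<in> carrier G" "t \<in> carrier G" "n \<ge> 1"
  shows "(s \<otimes> t) [^] n =
    s [^] n \<otimes> (s [^] (- int n + 1) \<otimes> (t \<otimes> s) [^] (int n - 1) \<otimes> t [^] (- int n + 1)) \<otimes> t [^] n"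
proof -
  obtain m where n: "n = Suc m" using assms(3) by (cases n) auto
  have s: "s [^] n \<otimes> s [^] (- int n + 1) = s"
    using int_pow_mult[OF assms(1), of "int n" "- int n + 1"] assms(1) by (simp add: int_pow_int)
  have t: "t [^] (- int n + 1) \<otimes> t [^] n = t"
    using int_pow_mult[OF assms(2), of "- int n + 1" "int n"] assms(2) by (simp add: int_pow_int)
  have ts: "(t \<otimes> s) [^] (int n - 1) = (t \<otimes> s) [^] m"
    using n by (simp add: int_pow_int)
  have "s [^] n \<otimes> (s [^] (- int n + 1) \<otimes> (t \<otimes> s) [^] (int n - 1) \<otimes> t [^] (- int n + 1)) \<otimes> t [^] n
    = (s [^] n \<otimes> s [^] (- int n + 1)) \<otimes> (t \<otimes> s) [^] (int n - 1) \<otimes> (t [^] (- int n + 1) \<otimes> t [^] n)"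
    using assms by (simp add: m_assoc del: nat_pow_Suc)
  also have "\<dots> = (s \<otimes> t) [^] n"
    unfolding s t ts unfolding n by (rule nat_pow_Suc_mult_swap[OF assms(1,2), symmetric])
  finally show ?thesis ..
qed

lemma unitary_op_bij: "unitary_op T \<Longrightarrow> bij T"
  unfolding unitary_op_def using o_bij by blast

context
  fixes G :: "('g, 'm) monoid_scheme" (structure)
    and U :: "'g \<Rightarrow> 'h::complex_hilbert_space \<Rightarrow> 'h"
  assumes grp: "group G" and rep: "unitary_representation G U"
begin

interpretation group G by (fact grp)

lemma unitary_representation_one: "U \<one> = id"
  using rep by (simp add: unitary_representation_def)

lemma unitary_representation_mult:
  "s \<in> carrier G \<Longrightarrow> t \<in> carrier G \<Longrightarrow> U (s \<otimes> t) = U s \<circ> U t"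
  using rep by (simp add: unitary_representation_def)

lemma unitary_representation_bij: "s \<in> carrier G \<Longrightarrow> bij (U s)"
  using rep by (simp add: unitary_representation_def unitary_op_bij)

lemma unitary_representation_pow: "s \<in> carrier G \<Longrightarrow> U (s [^] (n::nat)) = U s ^^ n"
  \<comment> \<open>\<open>[^]\<close> appends the new factor on the right, whereas the defining
    equation of \<open>^^\<close> puts it on the left; hence
    \<open>funpow_Suc_right\<close>.\<close>
  by (induction n)
    (simp_all add: unitary_representation_one unitary_representation_mult funpow_Suc_right del: funpow.simps(2))

lemma unitary_representation_kernel_subgroup: "subgroup {g \<in> carrier G. U g = id} G"
proof (rule subgroupI)
  fix a assume a: "a \<in> {g \<in> carrier G. U g = id}"
  \<comment> \<open>Composing with \<open>U a = id\<close> changes nothing, and the product on the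
    right is \<open>\<one>\<close>.\<close>
  then have "U (inv a) = U (inv a \<otimes> a)"
    by (subst unitary_representation_mult) auto
  then show "inv a \<in> {g \<in> carrier G. U g = id}"
    using a by (simp add: unitary_representation_one)
qed (use unitary_representation_one in \<open>auto simp: unitary_representation_mult\<close>)

text \<open>The right side is \<open>U a \<circ> U x \<circ> U b\<close>. Injectivity of
  \<open>U a\<close> cancels it on the left, surjectivity of \<open>U b\<close> on the
  right.\<close>

lemma unitary_representation_sandwich_eq_iff:
  assumes "a \<in> carrier G" "x \<in> carrier G" "b \<in> carrier G"
  shows "U a \<circ> U b = U (a \<otimes> x \<otimes> b) \<longleftrightarrow> U x = id"
proof
  assume eq: "U a \<circ> U b = U (a \<otimes> x \<otimes> b)"
  show "U x = id"
  proof
    fix v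
    obtain w where "v = U b w"
      using bij_is_surj[OF unitary_representation_bij[OF assms(3)]] by (metis surjD)
    moreover have "U a (U b w) = U a (U x (U b w))"
      using fun_cong[OF eq, of w] assms by (simp add: unitary_representation_mult)
    ultimately show "U x v = id v"
      using bij_is_inj[OF unitary_representation_bij[OF assms(1)]] by (simp add: inj_eq)
  qed
qed (use assms in \<open>simp add: unitary_representation_mult\<close>)

text \<open>Moving the power from the operator to the group element leaves only multiplicativity to
  check, in a form to which the cancellation above applies.\<close>

lemma unitary_representation_funpow_iff:
  "unitary_representation G (\<lambda>s. U s ^^ n) \<longleftrightarrow>
    (\<forall>s\<in>carrier G. \<forall>t\<in>carrier G. U (s [^] n) \<circ> U (t [^] n) = U ((s \<otimes> t) [^] n))"
proof -
  have "unitary_op (U s ^^ n)" if "s \<in> carrier G" for s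
    using that rep by (simp add: unitary_representation_def flip: unitary_representation_pow)
  then show ?thesis
    by (simp add: unitary_representation_def unitary_representation_one unitary_representation_pow)
qed

end

theorem lemma6p9:
  fixes G :: "('g, 'm) monoid_scheme"
    and U :: "'g \<Rightarrow> 'h::complex_hilbert_space \<Rightarrow> 'h"
    and n :: nat
  assumes "group G"
    and "unitary_representation G U"
    and "n \<ge> 1"
  shows "unitary_representation G (\<lambda>s. U s ^^ n) \<longleftrightarrow> (\<forall>g \<in> power_subgroup G n. U g = id)"
proof -
  interpret group G by (fact assms(1))
  define x where "x s t = s [^]\<^bsub>G\<^esub> (- int n + 1) \<otimes>\<^bsub>G\<^esub> (t \<otimes>\<^bsub>G\<^esub> s) [^]\<^bsub>G\<^esub> (int n - 1)
    \<otimes>\<^bsub>G\<^esub> t [^]\<^bsub>G\<^esub> (- int n + 1)" for s t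
  define X where "X = {x s t | s t. s \<in> carrier G \<and> t \<in> carrier G}"
  have ball_X: "(\<forall>g\<in>X. P g) \<longleftrightarrow> (\<forall>s\<in>carrier G. \<forall>t\<in>carrier G. P (x s t))" for P
    unfolding X_def by blast
  have x_closed: "x s t \<in> carrier G" if "s \<in> carrier G" "t \<in> carrier G" for s t
    using that by (simp add: x_def)
  \<comment> \<open>Cancellation with \<open>a = s [^] n\<close> and \<open>b = t [^] n\<close>
    around the generator \<open>x s t\<close>.\<close>
  have "unitary_representation G (\<lambda>s. U s ^^ n) \<longleftrightarrow>
    (\<forall>s\<in>carrier G. \<forall>t\<in>carrier G. U (x s t) = id)"
    unfolding unitary_representation_funpow_iff[OF assms(1,2)]
    using nat_pow_mult_eq_generator[OF _ _ assms(3), folded x_def] x_closed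
      unitary_representation_sandwich_eq_iff[OF assms(1,2)]
    by simp
  also have "\<dots> \<longleftrightarrow> X \<subseteq> {g \<in> carrier G. U g = id}"
    unfolding subset_eq ball_X using x_closed by simp
  \<comment> \<open>\<open>generate G X\<close> is the least subgroup containing \<open>X\<close>,
    and the kernel is a subgroup.\<close>
  also have "\<dots> \<longleftrightarrow> generate G X \<subseteq> {g \<in> carrier G. U g = id}"
  proof
    assume "X \<subseteq> {g \<in> carrier G. U g = id}"
    then show "generate G X \<subseteq> {g \<in> carrier G. U g = id}"
      by (rule generate_subgroup_incl[OF _ unitary_representation_kernel_subgroup[OF assms(1,2)]])
  next
    assume "generate G X \<subseteq> {g \<in> carrier G. U g = id}"
    then show "X \<subseteq> {g \<in> carrier G. U g = id}"
      by (meson generate.incl subset_eq)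
  qed
  also have "\<dots> \<longleftrightarrow> (\<forall>g \<in> generate G X. U g = id)"
  proof -
    have "X \<subseteq> carrier G"
      unfolding subset_eq ball_X using x_closed by simp
    then have "generate G X \<subseteq> carrier G"
      by (rule generate_incl)
    then show ?thesis by blast
  qed
  finally show ?thesis
    unfolding power_subgroup_def X_def x_def .
qed

end
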